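(* Let $(S,* )$ be an adequate partial semigroup, let $r$ be an idempotent in $J(S)$ (that is, $r\in J(S)$ and $r*r=r$), and let $(C_n)_{n=1}^\infty$ be a sequence of members of $r$. Then there exist a function $m^*:\mathcal{P}_f(\mathcal{F})\to\mathbb{N}$, an assignment $\alpha$ giving for each $F\in\mathcal{P}_f(\mathcal{F})$ an element $\alpha(F)\in S^{m^*(F)+1}$, and an assignment $\mathcal{T}$ giving for each $F\in\mathcal{P}_f(\mathcal{F})$ an element $\mathcal{T}(F)\in\mathcal{J}_{m^*(F)}$, such that: (1) if $F,G\in\mathcal{P}_f(\mathcal{F})$ and $G\subsetneq F$, then $\mathcal{T}(G)(m^*(G))<\mathcal{T}(F)(1)$; and (2) whenever $s,m\in\mathbb{N}$, $G_1,\dots,G_s\in\mathcal{P}_f(\mathcal{F})$ with $G_1\subsetneq G_2\subsetneq\cdots\subsetneq G_s$ and $|G_1|=m$, and $f_i\in G_i$ for $i=1,\dots,s$, the product $x_1*x_2*\cdots*x_s$ is defined and belongs to $C_m$, where for each $i$, \[x_i=\alpha(G_i)(1)*f_i(\mathcal{T}(G_i)(1))*\alpha(G_i)(2)*f_i(\mathcal{T}(G_i)(2))*\cdots*\alpha(G_i)(m^*(G_i))*f_i(\mathcal{T}(G_i)(m^*(G_i)))*\alpha(G_i)(m^*(G_i)+1).\]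
   Context: A partial semigroup is a pair $(S,* )$ where $*$ maps a subset of $S\times S$ into $S$ and for all $a,b,c\in S$, $(a*b)*c=a*(b*c)$ in the sense that if either side is defined then so is the other and they are equal. For $s\in S$, $\varphi(s)=\{t\in S: s*t\text{ is defined}\}$; for a finite nonempty $H\subseteq S$, $\sigma(H)=\bigcap_{s\in H}\varphi(s)$, and $\sigma(\emptyset)=S$. $(S,* )$ is adequate if $\sigma(H)\neq\emptyset$ for every finite nonempty $H\subseteq S$. For $s\in S$ and $A\subseteq S$, $s^{-1}A=\{t\in\varphi(s): s*t\in A\}$. $\beta S$ is the set of ultrafilters on $S$, and $\delta S=\{p\in\beta S:\varphi(x)\in p\text{ for all }x\in S\}$. For $p\in\beta S$ and $q\in\delta S$, $p*q=\{A\subseteq S:\{a\in S: a^{-1}A\in q\}\in p\}$; for adequate $S$, $(\delta S,* )$ is a compact Hausdorff right topological semigroup. $\mathcal{P}_f(X)$ is the set of finite nonempty subsets of $X$. For $m\in\mathbb{N}$, $\mathcal{J}_m=\{t\in\mathbb{N}^m: t(1)<t(2)<\cdots<t(m)\}$. A sequence $f$ in $S$ is adequate if (i) for each $H\in\mathcal{P}_f(\mathbb{N})$ the product $\prod_{t\in H}f(t)$ (taken in increasing order of $t$) is defined, and (ii) for each $F\in\mathcal{P}_f(S)$ there is $m\in\mathbb{N}$ with $\{\prod_{t\in H}f(t): H\in\mathcal{P}_f(\mathbb{N}),\min H\ge m\}\subseteq\sigma(F)$. $\mathcal{F}$ denotes the set of all adequate sequences in $S$. A set $A\subseteq S$ is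 a $J$-set if for all $F\in\mathcal{P}_f(\mathcal{F})$ and all $L\in\mathcal{P}_f(S)$ there exist $m\in\mathbb{N}$, $a\in S^{m+1}$ and $t\in\mathcal{J}_m$ such that for all $f\in F$, $a(1)*f(t(1))*a(2)*f(t(2))*\cdots*a(m)*f(t(m))*a(m+1)\in A\cap\sigma(L)$. $J(S)=\{p\in\delta S: \text{every }A\in p\text{ is a }J\text{-set}\}$. *)

theory Defs
  imports Main "HOL-Library.FuncSet"
begin

text \<open>
  The underlying set \<open>S\<close> is the whole type \<open>'a\<close>; \<open>mul a b = None\<close> means that \<open>a * b\<close> is
  undefined. The natural numbers of the source are \<open>{1..}\<close>. Tuples \<open>(x(1), ..., x(n))\<close> are
  functions on \<open>nat\<close> of which only the values on \<open>{1..n}\<close> are used.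
\<close>

text \<open>Equality of the two sides as options says: if either is defined, so is the other, and they agree.\<close>

definition partial_semigroup :: "('a \<Rightarrow> 'a \<Rightarrow> 'a option) \<Rightarrow> bool" where
  "partial_semigroup mul \<longleftrightarrow>
     (\<forall>a b c. Option.bind (mul a b) (\<lambda>x. mul x c) = Option.bind (mul b c) (\<lambda>y. mul a y))"

definition ps_phi :: "('a \<Rightarrow> 'a \<Rightarrow> 'a option) \<Rightarrow> 'a \<Rightarrow> 'a set" where
  "ps_phi mul s = {t. mul s t \<noteq> None}"

definition ps_sigma :: "('a \<Rightarrow> 'a \<Rightarrow> 'a option) \<Rightarrow> 'a set \<Rightarrow> 'a set" where
  "ps_sigma mul H = (\<Inter>s\<in>H. ps_phi mul s)"

definition ps_Pf :: "'b set \<Rightarrow> 'b set set" where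
  "ps_Pf X = {H. finite H \<and> H \<noteq> {} \<and> H \<subseteq> X}"

definition adequate_partial_semigroup :: "('a \<Rightarrow> 'a \<Rightarrow> 'a option) \<Rightarrow> bool" where
  "adequate_partial_semigroup mul \<longleftrightarrow>
     partial_semigroup mul \<and> (\<forall>H \<in> ps_Pf UNIV. ps_sigma mul H \<noteq> {})"

definition ps_quot :: "('a \<Rightarrow> 'a \<Rightarrow> 'a option) \<Rightarrow> 'a \<Rightarrow> 'a set \<Rightarrow> 'a set" where
  "ps_quot mul s A = {t. \<exists>u\<in>A. mul s t = Some u}"

definition ps_beta :: "'a set set set" where
  "ps_beta = {p. UNIV \<in> p \<and> {} \<notin> p \<and>
     (\<forall>A B. A \<in> p \<longrightarrow> B \<in> p \<longrightarrow> A \<inter> B \<in> p) \<and>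
     (\<forall>A B. A \<in> p \<longrightarrow> A \<subseteq> B \<longrightarrow> B \<in> p) \<and>
     (\<forall>A. A \<in> p \<or> - A \<in> p)}"

definition ps_delta :: "('a \<Rightarrow> 'a \<Rightarrow> 'a option) \<Rightarrow> 'a set set set" where
  "ps_delta mul = {p \<in> ps_beta. \<forall>x. ps_phi mul x \<in> p}"

definition ps_uprod :: "('a \<Rightarrow> 'a \<Rightarrow> 'a option) \<Rightarrow> 'a set set \<Rightarrow> 'a set set \<Rightarrow> 'a set set" where
  "ps_uprod mul p q = {A. {a. ps_quot mul a A \<in> q} \<in> p}"

text \<open>
  The product \<open>x\<^sub>1 * ... * x\<^sub>n\<close> of a nonempty list, \<open>None\<close> if undefined. By associativity the
  bracketing is irrelevant, also for definedness. There is no empty product.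
\<close>

fun ps_prod :: "('a \<Rightarrow> 'a \<Rightarrow> 'a option) \<Rightarrow> 'a list \<Rightarrow> 'a option" where
  "ps_prod mul [] = None"
| "ps_prod mul [x] = Some x"
| "ps_prod mul (x # y # ys) = Option.bind (ps_prod mul (y # ys)) (mul x)"

lemma ps_prod_append:
  assumes "partial_semigroup mul" "xs \<noteq> []" "ys \<noteq> []"
  shows "ps_prod mul (xs @ ys) =
    Option.bind (ps_prod mul xs) (\<lambda>x. Option.bind (ps_prod mul ys) (mul x))"
  using assms(2)
proof (induction xs rule: induct_list012)
  case 1
  then show ?case by simp
next
  case (2 x)
  obtain y zs where "ys = y # zs" using assms(3) by (cases ys) auto
  then show ?case by simp
next
  case (3 x y zs)
  have assoc: "Option.bind (mul a b) (\<lambda>x. mul x c) = Option.bind (mul b c) (\<lambda>y. mul a y)" for a b c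
    using assms(1) by (simp add: partial_semigroup_def)
  have "ps_prod mul ((x # y # zs) @ ys) = Option.bind (ps_prod mul ((y # zs) @ ys)) (mul x)"
    by simp
  also have "\<dots> = Option.bind (Option.bind (ps_prod mul (y # zs))
      (\<lambda>x. Option.bind (ps_prod mul ys) (mul x))) (mul x)"
    using 3 by simp
  also have "\<dots> = Option.bind (ps_prod mul (x # y # zs)) (\<lambda>x. Option.bind (ps_prod mul ys) (mul x))"
    by (cases "ps_prod mul (y # zs)"; cases "ps_prod mul ys") (simp_all add: assoc)
  finally show ?case .
qed

definition ps_seq_prod :: "('a \<Rightarrow> 'a \<Rightarrow> 'a option) \<Rightarrow> (nat \<Rightarrow> 'a) \<Rightarrow> nat set \<Rightarrow> 'a option" where
  "ps_seq_prod mul f H = ps_prod mul (map f (sorted_list_of_set H))"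

text \<open>
  The set of all adequate sequences. Sequences are indexed by \<open>{1..}\<close>; extensionality makes them
  determined by their values there, so that cardinalities of sets of sequences are the right ones.
\<close>

definition ps_adequate_seqs :: "('a \<Rightarrow> 'a \<Rightarrow> 'a option) \<Rightarrow> (nat \<Rightarrow> 'a) set" where
  "ps_adequate_seqs mul = {f \<in> {1..} \<rightarrow>\<^sub>E UNIV.
     (\<forall>H \<in> ps_Pf {1..}. ps_seq_prod mul f H \<noteq> None) \<and>
     (\<forall>F \<in> ps_Pf UNIV. \<exists>m\<ge>1. \<forall>H \<in> ps_Pf {1..}. m \<le> Min H \<longrightarrow>
        ps_seq_prod mul f H \<in> Some ` ps_sigma mul F)}"

definition ps_Jm :: "nat \<Rightarrow> (nat \<Rightarrow> nat) set" where
  "ps_Jm m = {t. t \<in> {1..m} \<rightarrow> {1..} \<and> strict_mono_on {1..m} t}"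

text \<open>\<open>a(1) * f(t(1)) * a(2) * f(t(2)) * ... * a(m) * f(t(m)) * a(m+1)\<close>\<close>

definition ps_word ::
  "('a \<Rightarrow> 'a \<Rightarrow> 'a option) \<Rightarrow> nat \<Rightarrow> (nat \<Rightarrow> 'a) \<Rightarrow> (nat \<Rightarrow> nat) \<Rightarrow> (nat \<Rightarrow> 'a) \<Rightarrow> 'a option" where
  "ps_word mul m a t f =
     ps_prod mul (concat (map (\<lambda>i. [a i, f (t i)]) [1..<m+1]) @ [a (m+1)])"

definition ps_J_set :: "('a \<Rightarrow> 'a \<Rightarrow> 'a option) \<Rightarrow> 'a set \<Rightarrow> bool" where
  "ps_J_set mul A \<longleftrightarrow>
     (\<forall>F \<in> ps_Pf (ps_adequate_seqs mul). \<forall>L \<in> ps_Pf UNIV.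
        \<exists>m\<ge>1. \<exists>a. \<exists>t \<in> ps_Jm m. \<forall>f\<in>F. ps_word mul m a t f \<in> Some ` (A \<inter> ps_sigma mul L))"

definition ps_J :: "('a \<Rightarrow> 'a \<Rightarrow> 'a option) \<Rightarrow> 'a set set set" where
  "ps_J mul = {p \<in> ps_delta mul. \<forall>A\<in>p. ps_J_set mul A}"

end

theory Submission
  imports Defs
begin

text \<open>
  For \<open>C\<close> in the idempotent \<open>r\<close> let \<open>C\<^sup>\<star> = {x \<in> C. x\<^sup>-\<^sup>1C \<in> r}\<close>. Then \<open>C\<^sup>\<star> \<in> r\<close>, and \<open>x\<^sup>-\<^sup>1C\<^sup>\<star> \<in> r\<close> for every
  \<open>x \<in> C\<^sup>\<star>\<close>. The data of \<open>F\<close> are chosen by well-founded recursion along strict inclusion, such that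
  all products along chains ending in \<open>F\<close> lie in the sets \<open>C\<^sub>k\<^sup>\<star>\<close>: there are only finitely many
  products \<open>y \<in> C\<^sub>k\<^sup>\<star>\<close> along chains ending strictly below \<open>F\<close>, so the intersection of
  the sets \<open>y\<^sup>-\<^sup>1C\<^sub>k\<^sup>\<star>\<close> and of \<open>C\<^sup>\<star>\<close> for \<open>C = C\<^bsub>|F|\<^esub>\<close> is in \<open>r\<close>, hence a \<open>J\<close>-set. The times can be taken
  beyond any given bound, because shifting an adequate sequence gives an adequate sequence.
\<close>

section \<open>Star sets of members of an idempotent ultrafilter\<close>

definition ps_star :: "('a \<Rightarrow> 'a \<Rightarrow> 'a option) \<Rightarrow> 'a set set \<Rightarrow> 'a set \<Rightarrow> 'a set" where
  "ps_star mul r A = {x \<in> A. ps_quot mul x A \<in> r}"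

lemma ps_star_subset: "ps_star mul r A \<subseteq> A"
  by (auto simp: ps_star_def)

lemma ps_beta_Int:
  assumes "r \<in> ps_beta" "A \<in> r" "B \<in> r"
  shows "A \<inter> B \<in> r"
  using assms unfolding ps_beta_def by blast

lemma ps_beta_superset:
  assumes "r \<in> ps_beta" "A \<in> r" "A \<subseteq> B"
  shows "B \<in> r"
  using assms unfolding ps_beta_def by blast

text \<open>Idempotence read at \<open>A\<close>: since \<open>A\<close> is in \<open>r * r\<close>,
  the set of all \<open>a\<close> with \<open>ps_quot mul a A\<close> in \<open>r\<close> is itself
  in \<open>r\<close>.\<close>

lemma ps_star_mem:
  assumes "r \<in> ps_beta" "ps_uprod mul r r = r" "A \<in> r"
  shows "ps_star mul r A \<in> r"
proof -
  have "{a. ps_quot mul a A \<in> r} \<in> r"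
    using assms(2,3) by (auto simp: ps_uprod_def)
  moreover have "ps_star mul r A = A \<inter> {a. ps_quot mul a A \<in> r}"
    by (auto simp: ps_star_def)
  ultimately show ?thesis
    using assms(1,3) by (simp add: ps_beta_Int)
qed

lemma ps_quot_mul:
  assumes "partial_semigroup mul" "mul x t = Some z"
  shows "ps_quot mul t (ps_quot mul x A) = ps_quot mul z A"
proof -
  have "Option.bind (mul t u) (mul x) = mul z u" for u
    using assms unfolding partial_semigroup_def by (metis Option.bind.bind_lunit)
  then have "mul z u = Some v \<longleftrightarrow> (\<exists>y. mul t u = Some y \<and> mul x y = Some v)" for u v
    by (metis bind_eq_Some_conv)
  then show ?thesis
    unfolding ps_quot_def by blast
qed

text \<open>By associativity, dividing by \<open>x\<close> and then by \<open>t\<close> is dividing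
  by \<open>x * t\<close>. So the star of the quotient of \<open>A\<close> by \<open>x\<close> lies
  in the quotient of the star, and it is in \<open>r\<close> because the quotient of
  \<open>A\<close> is.\<close>

lemma ps_quot_star_mem:
  assumes "partial_semigroup mul" "r \<in> ps_beta" "ps_uprod mul r r = r" "x \<in> ps_star mul r A"
  shows "ps_quot mul x (ps_star mul r A) \<in> r"
proof -
  let ?B = "ps_quot mul x A"
  have "ps_star mul r ?B \<subseteq> ps_quot mul x (ps_star mul r A)"
  proof
    fix t assume t: "t \<in> ps_star mul r ?B"
    then obtain z where z: "mul x t = Some z" "z \<in> A"
      by (auto simp: ps_star_def ps_quot_def)
    with t have "ps_quot mul z A \<in> r"
      using ps_quot_mul[OF assms(1) z(1)] by (simp add: ps_star_def)
    with z show "t \<in> ps_quot mul x (ps_star mul r A)"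
      by (simp add: ps_quot_def ps_star_def)
  qed
  moreover have "ps_star mul r ?B \<in> r"
    using ps_star_mem[OF assms(2,3)] assms(4) by (simp add: ps_star_def)
  ultimately show ?thesis
    by (rule ps_beta_superset[OF assms(2), rotated])
qed

lemma ps_beta_INT:
  assumes "r \<in> ps_beta" "finite I" "\<And>i. i \<in> I \<Longrightarrow> B i \<in> r"
  shows "(\<Inter>i\<in>I. B i) \<in> r"
  using assms(2,3)
proof (induction I rule: finite_induct)
  case empty
  then show ?case
    using assms(1) by (simp add: ps_beta_def)
next
  case (insert i I)
  then show ?case
    by (simp add: ps_beta_Int[OF assms(1)])
qed

section \<open>Shifting adequate sequences to reach late times\<close>

definition seq_shift :: "nat \<Rightarrow> (nat \<Rightarrow> 'a) \<Rightarrow> nat \<Rightarrow> 'a" where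
  "seq_shift k f = (\<lambda>n\<in>{1..}. f (n + k))"

lemma sorted_list_of_set_shift:
  fixes H :: "nat set"
  assumes "finite H"
  shows "sorted_list_of_set ((\<lambda>i. i + k) ` H) = map (\<lambda>i. i + k) (sorted_list_of_set H)"
proof (rule sorted_distinct_set_unique)
  show "sorted (map (\<lambda>i. i + k) (sorted_list_of_set H))"
    using sorted_sorted_list_of_set[of H] by (simp add: sorted_map)
qed (use assms in \<open>simp_all add: distinct_map\<close>)

lemma ps_seq_prod_shift:
  assumes "H \<in> ps_Pf {1..}"
  shows "ps_seq_prod mul (seq_shift k f) H = ps_seq_prod mul f ((\<lambda>i. i + k) ` H)"
proof -
  have "map (seq_shift k f) (sorted_list_of_set H) = map (\<lambda>i. f (i + k)) (sorted_list_of_set H)"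
    using assms by (auto simp: ps_Pf_def seq_shift_def)
  with assms show ?thesis
    by (simp add: ps_seq_prod_def ps_Pf_def sorted_list_of_set_shift comp_def del: map_eq_conv)
qed

text \<open>Products of the shifted sequence over \<open>H\<close> are products of \<open>f\<close>
  over \<open>H\<close> moved up by \<open>k\<close>. The minimum only grows, so the same
  \<open>m\<close> works.\<close>

lemma seq_shift_adequate:
  assumes "f \<in> ps_adequate_seqs mul"
  shows "seq_shift k f \<in> ps_adequate_seqs mul"
proof -
  have shift_Pf: "(\<lambda>i. i + k) ` H \<in> ps_Pf {1..}" if "H \<in> ps_Pf {1..}" for H
    using that by (fastforce simp: ps_Pf_def)
  have "\<exists>m\<ge>1. \<forall>H \<in> ps_Pf {1..}. m \<le> Min H \<longrightarrow>
      ps_seq_prod mul (seq_shift k f) H \<in> Some ` ps_sigma mul F" if F: "F \<in> ps_Pf UNIV" for F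
  proof -
    obtain m where m: "m \<ge> 1"
      "\<And>H. H \<in> ps_Pf {1..} \<Longrightarrow> m \<le> Min H \<Longrightarrow> ps_seq_prod mul f H \<in> Some ` ps_sigma mul F"
      using assms F unfolding ps_adequate_seqs_def by blast
    have "m \<le> Min ((\<lambda>i. i + k) ` H)" if "H \<in> ps_Pf {1..}" "m \<le> Min H" for H
      using that by (auto simp: ps_Pf_def trans_le_add1)
    with m shift_Pf show ?thesis
      by (metis ps_seq_prod_shift)
  qed
  moreover have "ps_seq_prod mul (seq_shift k f) H \<noteq> None" if "H \<in> ps_Pf {1..}" for H
    using assms shift_Pf that by (simp add: ps_seq_prod_shift ps_adequate_seqs_def)
  moreover have "seq_shift k f \<in> {1..} \<rightarrow>\<^sub>E UNIV"
    by (simp add: seq_shift_def)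
  ultimately show ?thesis
    unfolding ps_adequate_seqs_def by blast
qed

lemma ps_word_shift:
  assumes "t \<in> ps_Jm m"
  shows "ps_word mul m a t (seq_shift k f) = ps_word mul m a (\<lambda>i. t i + k) f"
proof -
  have "map (\<lambda>i. [a i, seq_shift k f (t i)]) [1..<m+1] = map (\<lambda>i. [a i, f (t i + k)]) [1..<m+1]"
    using assms by (fastforce simp: ps_Jm_def seq_shift_def)
  then show ?thesis
    by (simp only: ps_word_def)
qed

text \<open>Apply the \<open>J\<close>-set property to the sequences shifted by \<open>k\<close>,
  then add \<open>k\<close> to the times found.\<close>

lemma ps_J_set_beyond:
  assumes "ps_J_set mul A" "F \<in> ps_Pf (ps_adequate_seqs mul)"
  obtains m a t where "m \<ge> 1" "t \<in> ps_Jm m" "k < t 1"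
    "\<And>f. f \<in> F \<Longrightarrow> ps_word mul m a t f \<in> Some ` A"
proof -
  have F: "seq_shift k ` F \<in> ps_Pf (ps_adequate_seqs mul)"
    using assms(2) seq_shift_adequate by (auto simp: ps_Pf_def)
  \<comment> \<open>\<open>L\<close> ranges over nonempty sets, so some element has to be named; any
    one serves.\<close>
  have L: "{undefined} \<in> ps_Pf UNIV"
    by (simp add: ps_Pf_def)
  have "\<exists>m\<ge>1. \<exists>a. \<exists>t \<in> ps_Jm m. \<forall>f \<in> seq_shift k ` F.
      ps_word mul m a t f \<in> Some ` (A \<inter> ps_sigma mul {undefined})"
    by (rule bspec[OF bspec[OF assms(1)[unfolded ps_J_set_def] F] L])
  then obtain m a t where *: "m \<ge> 1" "t \<in> ps_Jm m"
    "\<forall>f \<in> seq_shift k ` F. ps_word mul m a t f \<in> Some ` (A \<inter> ps_sigma mul {undefined})"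
    by (elim exE conjE bexE)
  show thesis
  proof (rule that)
    show "(\<lambda>i. t i + k) \<in> ps_Jm m"
      using *(2) by (auto simp: ps_Jm_def strict_mono_on_def Pi_iff trans_le_add1)
    \<comment> \<open>Strict because times start at 1.\<close>
    show "k < t 1 + k"
      using funcset_mem[of t "{1..m}" "{1..}" 1] *(1,2) by (auto simp: ps_Jm_def)
    show "ps_word mul m a (\<lambda>i. t i + k) f \<in> Some ` A" if "f \<in> F" for f
      using bspec[OF *(3) imageI[OF that]] unfolding ps_word_shift[OF *(2)] by fast
  qed (fact *(1))
qed

text \<open>\<open>ps_prod\<close> recurses from the left, while chains grow at their right
  end.\<close>

lemma ps_prod_snoc:
  assumes "partial_semigroup mul" "xs \<noteq> []" "ps_prod mul xs = Some y"
  shows "ps_prod mul (xs @ [x]) = mul y x"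
  using ps_prod_append[OF assms(1,2), of "[x]"] assms(3) by simp

text \<open>
  A state \<open>(m, a, t, E)\<close> for \<open>F\<close> consists of the data \<open>m\<^sup>*(F)\<close>, \<open>\<alpha>(F)\<close>, \<open>\<T>(F)\<close> and a finite set \<open>E\<close> that
  contains \<open>(|G\<^sub>1|, y)\<close> for every product \<open>y = x\<^sub>1 * \<dots> * x\<^sub>s\<close> along a chain \<open>G\<^sub>1 \<subset> \<dots> \<subset> G\<^sub>s = F\<close>.
\<close>

type_synonym 'a state = "nat \<times> (nat \<Rightarrow> 'a) \<times> (nat \<Rightarrow> nat) \<times> (nat \<times> 'a) set"

definition last_time :: "'a state \<Rightarrow> nat" where
  "last_time = (\<lambda>(m, a, t, E). t m)"

definition chain_prods :: "'a state \<Rightarrow> (nat \<times> 'a) set" where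
  "chain_prods = (\<lambda>(m, a, t, E). E)"

text \<open>The clause on \<open>f\<close> makes \<open>E\<close> contain the chain consisting of
  \<open>F\<close> alone and every one-step extension by \<open>F\<close> of a recorded product. The
  label \<open>k\<close> is kept under extension, so it still names the target set. Only values of
  \<open>g\<close> strictly below \<open>F\<close> matter, which permits recursion.\<close>

definition admissible ::
  "('a \<Rightarrow> 'a \<Rightarrow> 'a option) \<Rightarrow> 'a set set \<Rightarrow> (nat \<Rightarrow> 'a set) \<Rightarrow> ((nat \<Rightarrow> 'a) set \<Rightarrow> 'a state) \<Rightarrow>
    (nat \<Rightarrow> 'a) set \<Rightarrow> 'a state \<Rightarrow> bool" where
  "admissible mul r C g F = (\<lambda>(m, a, t, E).
     m \<ge> 1 \<and> t \<in> ps_Jm m \<and>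
     (\<forall>G \<in> ps_Pf (ps_adequate_seqs mul). G \<subset> F \<longrightarrow> last_time (g G) < t 1) \<and>
     finite E \<and> E \<subseteq> (SIGMA k:{1..}. ps_star mul r (C k)) \<and>
     (\<forall>f\<in>F. \<exists>x. ps_word mul m a t f = Some x \<and> (card F, x) \<in> E \<and>
       (\<forall>G \<in> ps_Pf (ps_adequate_seqs mul). G \<subset> F \<longrightarrow>
         (\<forall>(k, y) \<in> chain_prods (g G). \<exists>z. mul y x = Some z \<and> (k, z) \<in> E))))"

section \<open>Recursive choice of the data\<close>

lemma admissible_exists:
  assumes "partial_semigroup mul" and r: "r \<in> ps_J mul" "ps_uprod mul r r = r"
    and C: "\<And>n. n \<ge> 1 \<Longrightarrow> C n \<in> r"
    and F: "F \<in> ps_Pf (ps_adequate_seqs mul)"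
    and g: "\<And>G. G \<in> ps_Pf (ps_adequate_seqs mul) \<Longrightarrow> G \<subset> F \<Longrightarrow> admissible mul r C g G (g G)"
  shows "\<exists>s. admissible mul r C g F s"
proof -
  let ?K = "SIGMA k:{1..}. ps_star mul r (C k)"
  define below where "below = {G \<in> ps_Pf (ps_adequate_seqs mul). G \<subset> F}"
  define P where "P = (\<Union>G\<in>below. chain_prods (g G))"
  \<comment> \<open>The first factor serves the chain \<open>F\<close> alone, the others serve
    chains extended by \<open>F\<close>.\<close>
  define D where
    "D = ps_star mul r (C (card F)) \<inter> (\<Inter>(k, y)\<in>P. ps_quot mul y (ps_star mul r (C k)))"
  have r_beta: "r \<in> ps_beta"
    using r(1) by (simp add: ps_J_def ps_delta_def)
  have fin_F: "finite F" and card_F: "card F \<ge> 1"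
    using F by (auto simp: ps_Pf_def Suc_le_eq card_gt_0_iff)
  have fin_below: "finite below"
    by (rule finite_subset[of _ "Pow F"]) (use fin_F in \<open>auto simp: below_def\<close>)
  have "finite (chain_prods (g G)) \<and> chain_prods (g G) \<subseteq> ?K" if "G \<in> below" for G
    using g[of G] that
    by (auto simp: below_def admissible_def chain_prods_def split: prod.splits)
  then have P: "finite P" "P \<subseteq> ?K"
    using fin_below unfolding P_def by blast+
  have "(\<Inter>(k, y)\<in>P. ps_quot mul y (ps_star mul r (C k))) \<in> r"
    using P by (intro ps_beta_INT r_beta)
      (auto intro!: ps_quot_star_mem[OF assms(1) r_beta r(2)])
  moreover have "ps_star mul r (C (card F)) \<in> r"
    by (intro ps_star_mem r_beta r(2) C card_F)
  ultimately have "D \<in> r"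
    using r_beta by (simp add: D_def ps_beta_Int)
  then have "ps_J_set mul D"
    using r(1) by (simp add: ps_J_def)
  \<comment> \<open>The sum bounds all earlier last times at once, and is 0 if there are
    none.\<close>
  then obtain m a t where mat: "m \<ge> 1" "t \<in> ps_Jm m" "(\<Sum>G\<in>below. last_time (g G)) < t 1"
    "\<And>f. f \<in> F \<Longrightarrow> ps_word mul m a t f \<in> Some ` D"
    by (rule ps_J_set_beyond[OF _ F, where k = "\<Sum>G\<in>below. last_time (g G)"]) blast
  define w where "w f = the (ps_word mul m a t f)" for f
  have w: "ps_word mul m a t f = Some (w f)" "w f \<in> D" if "f \<in> F" for f
    using mat(4)[OF that] by (auto simp: w_def)
  define E where "E = (\<lambda>f. (card F, w f)) ` F \<union>
    (\<lambda>((k, y), f). (k, the (mul y (w f)))) ` (P \<times> F)"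
  \<comment> \<open>This justifies \<open>the\<close> in \<open>E\<close>: \<open>w f\<close> lies
    in \<open>D\<close>, so each product with a recorded \<open>y\<close> is defined and stays in
    the star set.\<close>
  have step: "\<exists>z. mul y (w f) = Some z \<and> z \<in> ps_star mul r (C k)" if "(k, y) \<in> P" "f \<in> F" for k y f
    using w(2)[OF that(2)] that(1) by (fastforce simp: D_def ps_quot_def)
  have "admissible mul r C g F (m, a, t, E)"
    unfolding admissible_def prod.case
  proof (intro conjI ballI impI mat(1,2))
    fix G assume "G \<in> ps_Pf (ps_adequate_seqs mul)" "G \<subset> F"
    then have "last_time (g G) \<le> (\<Sum>G\<in>below. last_time (g G))"
      by (intro member_le_sum fin_below) (auto simp: below_def)
    then show "last_time (g G) < t 1"
      using mat(3) by simp
  next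
    show "finite E"
      using P(1) fin_F by (simp add: E_def)
    show "E \<subseteq> ?K"
      using P(2) card_F step w(2) by (fastforce simp: E_def D_def)
  next
    fix f assume f: "f \<in> F"
    have "\<exists>z. mul y (w f) = Some z \<and> (k, z) \<in> E"
      if G: "G \<in> ps_Pf (ps_adequate_seqs mul)" "G \<subset> F" "(k, y) \<in> chain_prods (g G)" for G k y
    proof -
      have "(k, y) \<in> P"
        using G by (auto simp: P_def below_def)
      with step[OF this f] f show ?thesis
        by (force simp: E_def)
    qed
    moreover have "(card F, w f) \<in> E"
      using f by (simp add: E_def)
    ultimately show "\<exists>x. ps_word mul m a t f = Some x \<and> (card F, x) \<in> E \<and>
       (\<forall>G \<in> ps_Pf (ps_adequate_seqs mul). G \<subset> F \<longrightarrow>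
         (\<forall>(k, y) \<in> chain_prods (g G). \<exists>z. mul y x = Some z \<and> (k, z) \<in> E))"
      using w(1)[OF f] by blast
  qed
  then show ?thesis ..
qed

lemma admissible_choice:
  assumes "partial_semigroup mul" "r \<in> ps_J mul" "ps_uprod mul r r = r"
    and "\<And>n. n \<ge> 1 \<Longrightarrow> C n \<in> r"
  obtains g where "\<And>F. F \<in> ps_Pf (ps_adequate_seqs mul) \<Longrightarrow> admissible mul r C g F (g F)"
proof -
  let ?Pf = "ps_Pf (ps_adequate_seqs mul)"
  have "\<exists>g. \<forall>F. F \<in> ?Pf \<longrightarrow> admissible mul r C g F (g F)"
  proof (rule dependent_wf_choice[OF wf_finite_psubset,
        where P = "\<lambda>g F s. F \<in> ?Pf \<longrightarrow> admissible mul r C g F s"])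
    fix g h :: "(nat \<Rightarrow> 'a) set \<Rightarrow> 'a state" and F s
    assume eq: "\<And>G. (G, F) \<in> finite_psubset \<Longrightarrow> g G = h G"
    \<comment> \<open>Members of \<open>?Pf\<close> are finite, so every strict subset of
      \<open>F\<close> precedes it in \<open>finite_psubset\<close>, where \<open>g\<close> and
      \<open>h\<close> agree.\<close>
    have "admissible mul r C g F s = admissible mul r C h F s" if "F \<in> ?Pf"
    proof -
      have "g G = h G" if "G \<subset> F" for G
        using eq \<open>F \<in> ?Pf\<close> that by (simp add: finite_psubset_def ps_Pf_def)
      then show ?thesis
        unfolding admissible_def by (simp cong: conj_cong imp_cong)
    qed
    then show "(F \<in> ?Pf \<longrightarrow> admissible mul r C g F s) = (F \<in> ?Pf \<longrightarrow> admissible mul r C h F s)"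
      by blast
  next
    fix F and g :: "(nat \<Rightarrow> 'a) set \<Rightarrow> 'a state"
    assume IH: "\<And>G. (G, F) \<in> finite_psubset \<Longrightarrow> G \<in> ?Pf \<longrightarrow> admissible mul r C g G (g G)"
    show "\<exists>s. F \<in> ?Pf \<longrightarrow> admissible mul r C g F s"
    proof (cases "F \<in> ?Pf")
      case True
      then have "finite F"
        by (simp add: ps_Pf_def)
      then show ?thesis
        using admissible_exists[where C = C and g = g, OF assms True] IH
        by (simp add: finite_psubset_def)
    qed blast
  qed
  then show thesis
    using that by blast
qed

theorem theorem3p2:
  fixes mul :: "'a \<Rightarrow> 'a \<Rightarrow> 'a option"
    and r :: "'a set set"
    and C :: "nat \<Rightarrow> 'a set"
  assumes "adequate_partial_semigroup mul"
    and "r \<in> ps_J mul"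
    and "ps_uprod mul r r = r"
    and "\<And>n. n \<ge> 1 \<Longrightarrow> C n \<in> r"
  shows "\<exists>(mstar :: (nat \<Rightarrow> 'a) set \<Rightarrow> nat)
          (\<alpha> :: (nat \<Rightarrow> 'a) set \<Rightarrow> nat \<Rightarrow> 'a)
          (T :: (nat \<Rightarrow> 'a) set \<Rightarrow> nat \<Rightarrow> nat).
      (\<forall>F \<in> ps_Pf (ps_adequate_seqs mul). mstar F \<ge> 1 \<and> T F \<in> ps_Jm (mstar F)) \<and>
      (\<forall>F \<in> ps_Pf (ps_adequate_seqs mul). \<forall>G \<in> ps_Pf (ps_adequate_seqs mul).
         G \<subset> F \<longrightarrow> T G (mstar G) < T F 1) \<and>
      (\<forall>s\<ge>1. \<forall>m\<ge>1. \<forall>(G :: nat \<Rightarrow> (nat \<Rightarrow> 'a) set) (f :: nat \<Rightarrow> nat \<Rightarrow> 'a).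
         (\<forall>i\<in>{1..s}. G i \<in> ps_Pf (ps_adequate_seqs mul)) \<longrightarrow>
         (\<forall>i\<in>{1..<s}. G i \<subset> G (i + 1)) \<longrightarrow>
         card (G 1) = m \<longrightarrow>
         (\<forall>i\<in>{1..s}. f i \<in> G i) \<longrightarrow>
         (\<exists>x :: nat \<Rightarrow> 'a.
            (\<forall>i\<in>{1..s}. ps_word mul (mstar (G i)) (\<alpha> (G i)) (T (G i)) (f i) = Some (x i)) \<and>
            ps_prod mul (map x [1..<s+1]) \<in> Some ` C m))"
proof -
  let ?Pf = "ps_Pf (ps_adequate_seqs mul)"
  have sg: "partial_semigroup mul"
    using assms(1) by (simp add: adequate_partial_semigroup_def)
  obtain g where g: "\<And>F. F \<in> ?Pf \<Longrightarrow> admissible mul r C g F (g F)"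
    using admissible_choice[where C = C, OF sg assms(2-4)] by blast
  define mstar where "mstar F = fst (g F)" for F
  define \<alpha> where "\<alpha> F = fst (snd (g F))" for F
  define T where "T F = fst (snd (snd (g F)))" for F
  define E where "E F = chain_prods (g F)" for F
  define w where "w F f = the (ps_word mul (mstar F) (\<alpha> F) (T F) f)" for F f
  have g_eq: "g F = (mstar F, \<alpha> F, T F, E F)" for F
    by (simp add: mstar_def \<alpha>_def T_def E_def chain_prods_def split: prod.split)
  have adm: "mstar F \<ge> 1" "T F \<in> ps_Jm (mstar F)" "E F \<subseteq> (SIGMA k:{1..}. ps_star mul r (C k))"
    "\<forall>G \<in> ?Pf. G \<subset> F \<longrightarrow> T G (mstar G) < T F 1"
    "\<forall>f\<in>F. ps_word mul (mstar F) (\<alpha> F) (T F) f = Some (w F f) \<and> (card F, w F f) \<in> E F \<and>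
       (\<forall>G \<in> ?Pf. G \<subset> F \<longrightarrow> (\<forall>(k, y) \<in> E G. \<exists>z. mul y (w F f) = Some z \<and> (k, z) \<in> E F))"
    if "F \<in> ?Pf" for F
  proof -
    have "admissible mul r C g F (mstar F, \<alpha> F, T F, E F)"
      using g[OF that] by (simp only: g_eq)
    then have *: "mstar F \<ge> 1 \<and> T F \<in> ps_Jm (mstar F) \<and>
        (\<forall>G \<in> ?Pf. G \<subset> F \<longrightarrow> last_time (g G) < T F 1) \<and>
        finite (E F) \<and> E F \<subseteq> (SIGMA k:{1..}. ps_star mul r (C k)) \<and>
        (\<forall>f\<in>F. \<exists>x. ps_word mul (mstar F) (\<alpha> F) (T F) f = Some x \<and> (card F, x) \<in> E F \<and>
          (\<forall>G \<in> ?Pf. G \<subset> F \<longrightarrow> (\<forall>(k, y) \<in> E G. \<exists>z. mul y x = Some z \<and> (k, z) \<in> E F)))"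
      unfolding admissible_def prod.case E_def .
    then show "mstar F \<ge> 1" "T F \<in> ps_Jm (mstar F)"
      "E F \<subseteq> (SIGMA k:{1..}. ps_star mul r (C k))"
      by simp_all
    have "last_time (g G) = T G (mstar G)" for G
      by (simp add: g_eq last_time_def)
    with * show "\<forall>G \<in> ?Pf. G \<subset> F \<longrightarrow> T G (mstar G) < T F 1"
      by simp
    show "\<forall>f\<in>F. ps_word mul (mstar F) (\<alpha> F) (T F) f = Some (w F f) \<and> (card F, w F f) \<in> E F \<and>
        (\<forall>G \<in> ?Pf. G \<subset> F \<longrightarrow> (\<forall>(k, y) \<in> E G. \<exists>z. mul y (w F f) = Some z \<and> (k, z) \<in> E F))"
    proof
      fix f assume "f \<in> F"
      with * obtain x where x: "ps_word mul (mstar F) (\<alpha> F) (T F) f = Some x" "(card F, x) \<in> E F"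
        "\<forall>G \<in> ?Pf. G \<subset> F \<longrightarrow> (\<forall>(k, y) \<in> E G. \<exists>z. mul y x = Some z \<and> (k, z) \<in> E F)"
        by blast
      have "w F f = x"
        using x(1) by (simp add: w_def)
      show "ps_word mul (mstar F) (\<alpha> F) (T F) f = Some (w F f) \<and> (card F, w F f) \<in> E F \<and>
        (\<forall>G \<in> ?Pf. G \<subset> F \<longrightarrow> (\<forall>(k, y) \<in> E G. \<exists>z. mul y (w F f) = Some z \<and> (k, z) \<in> E F))"
        unfolding \<open>w F f = x\<close> by (intro conjI x)
    qed
  qed
  have step: "\<exists>z. mul y (w F f) = Some z \<and> (k, z) \<in> E F"
    if "G \<in> ?Pf" "F \<in> ?Pf" "G \<subset> F" "f \<in> F" "(k, y) \<in> E G" for F G f k y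
    using bspec[OF adm(5)[OF that(2)] that(4)] that(1,3,5) by blast
  \<comment> \<open>Induction on the length of the chain. The invariant records the product in
    \<open>E (G s)\<close> under the label \<open>card (G 1)\<close>, which \<open>step\<close>
    preserves.\<close>
  have chain: "\<exists>z. ps_prod mul (map (\<lambda>i. w (G i) (f i)) [1..<s+1]) = Some z \<and> (card (G 1), z) \<in> E (G s)"
    if "s \<ge> 1" "\<forall>i\<in>{1..s}. G i \<in> ?Pf" "\<forall>i\<in>{1..<s}. G i \<subset> G (i + 1)" "\<forall>i\<in>{1..s}. f i \<in> G i"
    for s G f
    using that
  proof (induction s rule: nat_induct_at_least)
    case base
    then show ?case
      using adm(5)[of "G 1"] by simp
  next
    case (Suc s)
    then obtain z where z: "ps_prod mul (map (\<lambda>i. w (G i) (f i)) [1..<s+1]) = Some z"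
      "(card (G 1), z) \<in> E (G s)"
      by auto
    have "G s \<in> ?Pf" "G (Suc s) \<in> ?Pf" "G s \<subset> G (Suc s)" "f (Suc s) \<in> G (Suc s)"
      using Suc by auto
    from step[OF this z(2)] obtain z' where "mul z (w (G (Suc s)) (f (Suc s))) = Some z'"
      "(card (G 1), z') \<in> E (G (Suc s))"
      by blast
    moreover have "map (\<lambda>i. w (G i) (f i)) [1..<Suc s+1] =
        map (\<lambda>i. w (G i) (f i)) [1..<s+1] @ [w (G (Suc s)) (f (Suc s))]"
      by simp
    ultimately show ?case
      using ps_prod_snoc[OF sg _ z(1)] Suc.hyps by simp
  qed
  show ?thesis
  proof (intro exI[of _ mstar] exI[of _ \<alpha>] exI[of _ T] conjI ballI allI impI)
    fix s m and G :: "nat \<Rightarrow> (nat \<Rightarrow> 'a) set" and f :: "nat \<Rightarrow> nat \<Rightarrow> 'a"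
    assume *: "1 \<le> s" "1 \<le> m" "\<forall>i\<in>{1..s}. G i \<in> ?Pf" "\<forall>i\<in>{1..<s}. G i \<subset> G (i + 1)"
      "card (G 1) = m" "\<forall>i\<in>{1..s}. f i \<in> G i"
    obtain z where z: "ps_prod mul (map (\<lambda>i. w (G i) (f i)) [1..<s+1]) = Some z" "(m, z) \<in> E (G s)"
      using chain[OF *(1,3,4,6)] *(5) by blast
    \<comment> \<open>The label \<open>m\<close> puts \<open>z\<close> in the star of
      \<open>C m\<close>.\<close>
    have "z \<in> C m"
      using z(2) adm(3)[of "G s"] *(1,3) ps_star_subset[of mul r "C m"] by auto
    with z(1) show "\<exists>x. (\<forall>i\<in>{1..s}. ps_word mul (mstar (G i)) (\<alpha> (G i)) (T (G i)) (f i) = Some (x i)) \<and>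
        ps_prod mul (map x [1..<s+1]) \<in> Some ` C m"
      using adm(5) *(3,6) by (intro exI[of _ "\<lambda>i. w (G i) (f i)"]) auto
  qed (use adm in auto)
qed

end
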